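(* Let $d \ge 0$ be an integer and let $\mathcal{F}$ be a family of subsets of $[d+3]=\{1,2,\dots,d+3\}$. Then the simplicial complex $\Sigma(\mathcal{F})$ embeds (topologically) into the $d$-sphere $S^d$ if and only if $\mathcal{F}$ is not intersecting.
   Context: For a family $\mathcal{F}$ of subsets of $[d+3]$, $\Sigma(\mathcal{F})$ denotes the simplicial complex on vertex set $[d+3]$ with missing faces $\mathcal{F}$, namely $\Sigma(\mathcal{F}) = \{ \sigma \subset [d+3] : \tau \notin \mathcal{F} \text{ for all } \tau \subset \sigma\}$. A family $\mathcal{F}$ is called intersecting if $\sigma \cap \tau \neq \emptyset$ for all $\sigma, \tau \in \mathcal{F}$. An embedding means a continuous injective map from the geometric realization. *)

theory Defs
  imports "HOL-Analysis.Analysis"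
begin

text \<open>The complex \<open>\<Sigma>(\<F>)\<close> on the vertex set \<open>[n] = {1..n}\<close>. Members of \<open>\<F>\<close> need not be pairwise
  incomparable, and \<open>\<F>\<close> may contain singletons or the empty set; in the last case the complex
  has no faces at all, not even the empty one.\<close>

definition missing_face_complex :: "nat \<Rightarrow> nat set set \<Rightarrow> nat set set" where
  "missing_face_complex n \<F> = {\<sigma>. \<sigma> \<subseteq> {1..n} \<and> (\<forall>\<tau>. \<tau> \<subseteq> \<sigma> \<longrightarrow> \<tau> \<notin> \<F>)}"

definition intersecting_family :: "'v set set \<Rightarrow> bool" where
  "intersecting_family \<F> \<longleftrightarrow> (\<forall>\<sigma>\<in>\<F>. \<forall>\<tau>\<in>\<F>. \<sigma> \<inter> \<tau> \<noteq> {})"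

text \<open>The realization in barycentric coordinates: the points are the functions \<open>x \<ge> 0\<close> on the
  vertices with coordinate sum \<open>1\<close> whose support is a face. The topology is inherited from the
  product topology; this is the usual topology of the realization for finite complexes, the only
  ones considered here (in general the weak topology is finer).\<close>

definition geometric_realization :: "'v set set \<Rightarrow> ('v \<Rightarrow> real) topology" where
  "geometric_realization K =
     subtopology (powertop_real UNIV)
       {x. (\<forall>v. 0 \<le> x v) \<and> {v. x v \<noteq> 0} \<in> K \<and> (\<Sum>v\<in>{v. x v \<noteq> 0}. x v) = 1}"

definition embeds_into :: "'v set set \<Rightarrow> 'b topology \<Rightarrow> bool" where
  "embeds_into K Y \<longleftrightarrow>
     (\<exists>f. continuous_map (geometric_realization K) Y f \<and>
          inj_on f (topspace (geometric_realization K)))"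

end

theory Submission
  imports Defs "HOL-Homology.Simplices"
begin

text \<open>If \<open>\<sigma>, \<tau> \<in> \<F>\<close> are disjoint, enlarge \<open>\<tau>\<close> to the complement of \<open>\<sigma>\<close>. Then the complex lies in the
  join of the boundaries of two disjoint simplices, which is a \<open>d\<close>-sphere: taking the differences of the
  coordinates with one fixed coordinate in each of the two simplices and normalizing is an embedding.

  If \<open>\<F>\<close> is intersecting, then of two disjoint sets of vertices at least one is a face. Given an
  embedding \<open>f\<close> into the \<open>d\<close>-sphere, split a point \<open>x\<close> of the \<open>\<ell>\<^sub>1\<close>-sphere in \<open>d + 3\<close> coordinates into
  its positive part \<open>y\<close> and its negative part \<open>z\<close>, and consider the \<open>d + 2\<close> odd functions consisting of
  the coordinates of \<open>\<bar>y\<bar> f (y / \<bar>y\<bar>) - \<bar>z\<bar> f (z / \<bar>z\<bar>)\<close>, with \<open>f\<close> extended by Tietze's theorem, and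
  \<open>q y - q z\<close>, where \<open>q\<close> is a polynomial whose zeros are the points of the complex. By the Borsuk-Ulam theorem
  they have a common zero. There \<open>y\<close> and \<open>z\<close> lie over the complex and \<open>f (y / \<bar>y\<bar>) = f (z / \<bar>z\<bar>)\<close>,
  although \<open>y\<close> and \<open>z\<close> have disjoint supports.

  The Borsuk-Ulam theorem is proved by evaluating a cup product on a subdivided singular chain. For odd
  functions without a common zero, the sign changes of the \<open>i\<close>-th function define a \<open>1\<close>-cocycle that
  vanishes on every simplex on which this function has no zero. So the product of all of them vanishes on
  sufficiently small simplices. On the other hand, by induction on the dimension, its value on a
  hemisphere is odd.\<close>

subsection \<open>The Borsuk-Ulam theorem\<close>

definition cross_sphere :: "nat \<Rightarrow> (nat \<Rightarrow> real) set" where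
  "cross_sphere n = {x. (\<forall>i>n. x i = 0) \<and> (\<Sum>i\<le>n. \<bar>x i\<bar>) = 1}"

abbreviation unit_at :: "nat \<Rightarrow> nat \<Rightarrow> real" where
  "unit_at i \<equiv> \<lambda>j. if j = i then 1 else 0"

definition neg_fun :: "(nat \<Rightarrow> real) \<Rightarrow> nat \<Rightarrow> real" where
  "neg_fun x = (\<lambda>i. - x i)"

lemma neg_fun_neg_fun [simp]: "neg_fun (neg_fun x) = x"
  by (simp add: neg_fun_def)

lemma neg_fun_cross_sphere: "neg_fun x \<in> cross_sphere n \<longleftrightarrow> x \<in> cross_sphere n"
  by (simp add: cross_sphere_def neg_fun_def)

lemma unit_at_cross_sphere: "i \<le> n \<Longrightarrow> unit_at i \<in> cross_sphere n"
  by (auto simp: cross_sphere_def if_distrib [of abs] cong: if_cong)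

text \<open>On a segment from the new pole to an equatorial point the l1-norms of the two parts add
  up, their supports being disjoint. So cones over chains stay in this sphere without
  normalization.\<close>

lemma cross_sphere_join:
  assumes "0 \<le> u" "u \<le> 1" "x \<in> cross_sphere n"
  shows "(\<lambda>i. (1 - u) * unit_at (Suc n) i + u * x i) \<in> cross_sphere (Suc n)"
proof -
  have "(\<Sum>i\<le>n. \<bar>(1 - u) * unit_at (Suc n) i + u * x i\<bar>) = (\<Sum>i\<le>n. u * \<bar>x i\<bar>)"
    using assms by (intro sum.cong) (auto simp: abs_mult)
  also have "\<dots> = u"
    using assms by (simp add: cross_sphere_def flip: sum_distrib_left)
  finally show ?thesis
    using assms by (auto simp: cross_sphere_def)
qed

lemma cross_sphere_mono: "m \<le> n \<Longrightarrow> cross_sphere m \<subseteq> cross_sphere n"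
proof
  fix x assume "m \<le> n" "x \<in> cross_sphere m"
  then have "(\<Sum>i\<le>n. \<bar>x i\<bar>) = (\<Sum>i\<le>m. \<bar>x i\<bar>)"
    by (intro sum.mono_neutral_right) (auto simp: cross_sphere_def)
  then show "x \<in> cross_sphere n"
    using \<open>m \<le> n\<close> \<open>x \<in> cross_sphere m\<close> by (auto simp: cross_sphere_def)
qed

abbreviation cross_top :: "nat \<Rightarrow> (nat \<Rightarrow> real) topology" where
  "cross_top n \<equiv> subtopology (powertop_real UNIV) (cross_sphere n)"

text \<open>The antipodal map is linear and so preserves affine simplices. This is what allows a
  simplicial cone over the equator.\<close>

lemma simplicial_chain_neg_fun:
  assumes "simplicial_chain p (cross_sphere n) c"
  shows "simplicial_chain p (cross_sphere n) (chain_map p neg_fun c)"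
  using assms unfolding simplicial_chain_def
proof (induction c rule: frag_induction)
  case (one f)
  then obtain l where f: "f = oriented_simplex p l" "f ` standard_simplex p \<subseteq> cross_sphere n"
    by (auto simp: simplicial_simplex)
  have "simplex_map p neg_fun f = oriented_simplex p (\<lambda>i. neg_fun (l i))"
    by (auto simp: f simplex_map_def oriented_simplex_def neg_fun_def fun_eq_iff sum_negf)
  moreover have "simplex_map p neg_fun f ` standard_simplex p \<subseteq> cross_sphere n"
    using f(2) by (auto simp: simplex_map_def neg_fun_cross_sphere)
  ultimately show ?case
    by (auto simp: simplicial_simplex)
next
  case (diff a b)
  then show ?case
    using keys_diff by (fastforce simp: chain_map_diff)
qed auto

text \<open>The sphere has a cell structure with two antipodal cells in each dimension; \<open>hemisphere k\<close> is one
  of the two \<open>k\<close>-cells. The sign in \<open>equator\<close> makes \<open>equator k (hemisphere k)\<close> a cycle.\<close>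

definition equator :: "nat \<Rightarrow> (nat \<Rightarrow> real) chain \<Rightarrow> (nat \<Rightarrow> real) chain" where
  "equator k c = c - frag_cmul ((-1) ^ k) (chain_map k neg_fun c)"

primrec hemisphere :: "nat \<Rightarrow> (nat \<Rightarrow> real) chain" where
  "hemisphere 0 = frag_of (oriented_simplex 0 (\<lambda>_. unit_at 0))"
| "hemisphere (Suc k) = simplicial_cone k (unit_at (Suc k)) (equator k (hemisphere k))"

lemma simplicial_chain_equator:
  "simplicial_chain k (cross_sphere n) c \<Longrightarrow> simplicial_chain k (cross_sphere n) (equator k c)"
  by (simp add: equator_def simplicial_chain_diff simplicial_chain_cmul simplicial_chain_neg_fun)

lemma simplicial_chain_hemisphere: "simplicial_chain k (cross_sphere k) (hemisphere k)"
proof (induction k)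
  case 0
  show ?case
    by (auto simp: simplicial_simplex_oriented_simplex standard_simplex_0 unit_at_cross_sphere)
next
  case (Suc k)
  show ?case
    unfolding hemisphere.simps
    by (rule simplicial_chain_simplicial_cone [OF simplicial_chain_equator [OF Suc]])
      (rule cross_sphere_join)
qed

lemma singular_chain_hemisphere:
  assumes "k \<le> n"
  shows "singular_chain k (cross_top n) (hemisphere k)"
proof -
  have "singular_chain k (cross_top k) (hemisphere k)"
    by (rule simplicial_imp_singular_chain [OF simplicial_chain_hemisphere])
  then show ?thesis
    using cross_sphere_mono [OF assms] singular_chain_mono by blast
qed

lemma chain_map_neg_fun_neg_fun:
  assumes "singular_chain k (cross_top n) c"
  shows "chain_map k neg_fun (chain_map k neg_fun c) = c"
proof -
  have "chain_map k (neg_fun \<circ> neg_fun) c = c"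
    by (rule chain_map_id_gen [OF assms]) simp
  then show ?thesis
    by (simp add: chain_map_compose)
qed

text \<open>A cone is bounded by its base minus the cone over the boundary of the base. In positive
  degree the base is a cycle by induction, so the second term vanishes.\<close>

lemma chain_boundary_hemisphere:
  "chain_boundary (Suc k) (hemisphere (Suc k)) = equator k (hemisphere k)"
proof (induction k)
  case 0
  have "chain_boundary (Suc 0) (hemisphere (Suc 0)) = equator 0 (hemisphere 0)
     - frag_extend (\<lambda>f. frag_of (\<lambda>u\<in>standard_simplex 0. unit_at (Suc 0))) (equator 0 (hemisphere 0))"
    using chain_boundary_simplicial_cone [OF simplicial_chain_equator [OF simplicial_chain_hemisphere], of 0]
    by simp
  \<comment> \<open>In degree 0 the correction term moves both points to the apex, with opposite
    signs, and cancels.\<close>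
  then show ?case
    by (simp add: equator_def frag_extend_diff)
next
  case (Suc k)
  let ?c = "hemisphere k"
  have sc: "singular_chain (Suc k) (cross_top (Suc k)) (hemisphere (Suc k))"
    by (rule singular_chain_hemisphere) simp
  have "chain_boundary (Suc k) (equator (Suc k) (hemisphere (Suc k)))
      = equator k ?c - frag_cmul ((-1) ^ Suc k) (chain_map k neg_fun (equator k ?c))"
    using chain_boundary_chain_map [OF sc, of neg_fun] Suc
    by (simp add: equator_def chain_boundary_diff chain_boundary_cmul)
  \<comment> \<open>Reflecting twice is the identity, and the signs of consecutive degrees make the
    four terms cancel in pairs.\<close>
  also have "\<dots> = 0"
    by (rule poly_mapping_eqI)
      (simp add: equator_def chain_map_diff lookup_minus lookup_add
        chain_map_neg_fun_neg_fun [OF singular_chain_hemisphere [OF order_refl]] algebra_simps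
        flip: power_add mult.assoc)
  finally have "chain_boundary (Suc k) (equator (Suc k) (hemisphere (Suc k))) = 0" .
  then show ?case
    using chain_boundary_simplicial_cone [OF simplicial_chain_equator [OF simplicial_chain_hemisphere], of "Suc k"]
    by (simp add: simplicial_cone_def)
qed

section \<open>Integer cochains and products of sign changes\<close>

text \<open>\<open>frag_extend\<close> takes values in free abelian groups only, so the integers
  appear as the free abelian group on the one-element type.\<close>

definition cochain_eval :: "('a \<Rightarrow> int) \<Rightarrow> ('a \<Rightarrow>\<^sub>0 int) \<Rightarrow> int" where
  "cochain_eval \<phi> c = Poly_Mapping.lookup (frag_extend (\<lambda>f. frag_cmul (\<phi> f) (frag_of ())) c) ()"

lemma cochain_eval_0 [simp]: "cochain_eval \<phi> 0 = 0"
  by (simp add: cochain_eval_def)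

lemma cochain_eval_of [simp]: "cochain_eval \<phi> (frag_of f) = \<phi> f"
  by (simp add: cochain_eval_def)

lemma cochain_eval_diff: "cochain_eval \<phi> (a - b) = cochain_eval \<phi> a - cochain_eval \<phi> b"
  by (simp add: cochain_eval_def frag_extend_diff lookup_minus)

lemma cochain_eval_add: "cochain_eval \<phi> (a + b) = cochain_eval \<phi> a + cochain_eval \<phi> b"
  by (simp add: cochain_eval_def frag_extend_add lookup_add)

lemma cochain_eval_cmul: "cochain_eval \<phi> (frag_cmul k a) = k * cochain_eval \<phi> a"
  by (simp add: cochain_eval_def frag_extend_cmul)

lemma cochain_eval_sum:
  "finite I \<Longrightarrow> cochain_eval \<phi> (\<Sum>i\<in>I. g i) = (\<Sum>i\<in>I. cochain_eval \<phi> (g i))"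
  by (induction I rule: finite_induct) (simp_all add: cochain_eval_add)

lemma cochain_eval_eq:
  "(\<And>f. f \<in> Poly_Mapping.keys c \<Longrightarrow> \<phi> f = \<psi> f) \<Longrightarrow> cochain_eval \<phi> c = cochain_eval \<psi> c"
  unfolding cochain_eval_def by (metis (no_types, lifting) frag_extend_eq)

lemma cochain_eval_eq_0:
  "(\<And>f. f \<in> Poly_Mapping.keys c \<Longrightarrow> \<phi> f = 0) \<Longrightarrow> cochain_eval \<phi> c = 0"
  unfolding cochain_eval_def by (simp add: frag_extend_eq_0)

lemma cochain_eval_linear:
  "cochain_eval (\<lambda>f. a * \<phi> f + b * \<psi> f) c = a * cochain_eval \<phi> c + b * cochain_eval \<psi> c"
  using subset_UNIV
  by (induction c rule: frag_induction) (auto simp: cochain_eval_diff algebra_simps)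

lemma cochain_eval_chain_map:
  "cochain_eval \<phi> (chain_map p g c) = cochain_eval (\<phi> \<circ> simplex_map p g) c"
  using subset_UNIV
  by (induction c rule: frag_induction) (auto simp: cochain_eval_diff chain_map_diff)

lemma cochain_eval_boundary:
  assumes "p \<noteq> 0"
  shows "cochain_eval \<phi> (chain_boundary p c)
    = cochain_eval (\<lambda>f. \<Sum>k\<le>p. (-1) ^ k * \<phi> (singular_face p k f)) c"
  using subset_UNIV assms
  by (induction c rule: frag_induction)
    (auto simp: cochain_eval_diff chain_boundary_diff chain_boundary_of cochain_eval_sum cochain_eval_cmul)

text \<open>\<open>jump_prod s k\<close> is the cup product of the cocycles \<open>\<delta>(s 0), \<dots>, \<delta>(s (k - 1))\<close>, evaluated on
  the simplex with vertices \<open>v 0, \<dots>, v k\<close>.\<close>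

definition jump_prod :: "(nat \<Rightarrow> 'a \<Rightarrow> int) \<Rightarrow> nat \<Rightarrow> (nat \<Rightarrow> 'a) \<Rightarrow> int" where
  "jump_prod s k v = (\<Prod>i<k. s i (v (Suc i)) - s i (v i))"

abbreviation omit :: "nat \<Rightarrow> (nat \<Rightarrow> 'a) \<Rightarrow> nat \<Rightarrow> 'a" where
  "omit j v \<equiv> \<lambda>i. if i < j then v i else v (Suc i)"

lemma jump_prod_cong:
  "(\<And>i. i \<le> k \<Longrightarrow> v i = w i) \<Longrightarrow> jump_prod s k v = jump_prod s k w"
  by (auto simp: jump_prod_def)

lemma jump_prod_Suc:
  "jump_prod s (Suc k) v = jump_prod s k v * (s k (v (Suc k)) - s k (v k))"
  by (simp add: jump_prod_def)

lemma jump_prod_omit_last: "k < j \<Longrightarrow> jump_prod s k (omit j v) = jump_prod s k v"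
  by (rule jump_prod_cong) auto

text \<open>In the inductive step, the faces that omit none of the last two vertices share the last
  factor, and the induction hypothesis sums them. The other two faces cancel this sum, since the
  differences of \<open>s k\<close> telescope.\<close>

lemma jump_prod_cocycle: "(\<Sum>j\<le>Suc k. (-1) ^ j * jump_prod s k (omit j v)) = 0"
proof (induction k)
  case 0
  show ?case by (simp add: jump_prod_def)
next
  case (Suc k)
  let ?w = "\<lambda>i j. s k (v j) - s k (v i)"
  have "(\<Sum>j\<le>k. (-1) ^ j * jump_prod s (Suc k) (omit j v))
      = (\<Sum>j\<le>k. (-1) ^ j * jump_prod s k (omit j v)) * ?w (Suc k) (Suc (Suc k))"
    unfolding sum_distrib_right
    by (rule sum.cong) (auto simp: jump_prod_Suc)
  moreover have "(\<Sum>j\<le>k. (-1) ^ j * jump_prod s k (omit j v)) = (-1) ^ k * jump_prod s k v"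
    using Suc by (simp add: jump_prod_omit_last)
  ultimately show ?case
    by (simp add: jump_prod_Suc jump_prod_omit_last algebra_simps)
qed

text \<open>The Leibniz rule for the cup product of a cocycle with the 0-cochain \<open>s k\<close>:
  only the term with the coboundary of \<open>s k\<close> survives.\<close>

lemma jump_prod_coboundary:
  "(\<Sum>j\<le>Suc k. (-1) ^ j * (jump_prod s k (omit j v) * s k (omit j v k)))
    = (-1) ^ k * jump_prod s (Suc k) v"
proof -
  have "(\<Sum>j\<le>k. (-1) ^ j * (jump_prod s k (omit j v) * s k (omit j v k)))
      = (\<Sum>j\<le>k. (-1) ^ j * jump_prod s k (omit j v)) * s k (v (Suc k))"
    unfolding sum_distrib_right by (rule sum.cong) auto
  moreover have "(\<Sum>j\<le>k. (-1) ^ j * jump_prod s k (omit j v)) = (-1) ^ k * jump_prod s k v"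
    using jump_prod_cocycle [where k = k and s = s and v = v] by (simp add: jump_prod_omit_last)
  ultimately show ?thesis
    by (simp add: jump_prod_Suc jump_prod_omit_last algebra_simps)
qed

abbreviation vertices :: "((nat \<Rightarrow> real) \<Rightarrow> 'a) \<Rightarrow> nat \<Rightarrow> 'a" where
  "vertices f \<equiv> \<lambda>i. f (unit_at i)"

lemma vertices_singular_face:
  assumes "k \<le> Suc p" "i \<le> p"
  shows "vertices (singular_face (Suc p) k f) i = omit k (vertices f) i"
proof -
  have "simplical_face k (unit_at i) = (if i < k then unit_at i else unit_at (Suc i))"
    using assms by (auto simp: simplical_face_def fun_eq_iff)
  then show ?thesis
    using assms by (simp add: singular_face_def)
qed

lemma vertices_simplex_map:
  "i \<le> p \<Longrightarrow> vertices (simplex_map p g f) i = g (vertices f i)"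
  by (simp add: simplex_map_def)

section \<open>Subdivided hemispheres and the parity of the product\<close>

lemma iterated_singular_subdivision_boundary:
  assumes "singular_chain (Suc p) X c"
  shows "singular_chain (Suc p) X ((singular_subdivision (Suc p) ^^ n) c) \<and>
    chain_boundary (Suc p) ((singular_subdivision (Suc p) ^^ n) c)
      = (singular_subdivision p ^^ n) (chain_boundary (Suc p) c)"
  by (induction n)
    (use assms in \<open>auto simp: singular_chain_singular_subdivision chain_boundary_singular_subdivision\<close>)

lemma singular_chain_iterated_subdivision:
  assumes "singular_chain p X c"
  shows "singular_chain p X ((singular_subdivision p ^^ n) c)"
  by (induction n) (use assms in \<open>auto simp: singular_chain_singular_subdivision\<close>)

lemma iterated_singular_subdivision_chain_map:
  assumes "singular_chain p X c"
  shows "(singular_subdivision p ^^ n) (chain_map p g c) = chain_map p g ((singular_subdivision p ^^ n) c)"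
  by (induction n)
    (auto simp: naturality_singular_subdivision [OF singular_chain_iterated_subdivision [OF assms]])

lemma iterated_singular_subdivision_cmul:
  "(singular_subdivision p ^^ n) (frag_cmul k c) = frag_cmul k ((singular_subdivision p ^^ n) c)"
  by (induction n) (auto simp: singular_subdivision_def frag_extend_cmul)

lemma iterated_singular_subdivision_equator:
  assumes "singular_chain k X c"
  shows "(singular_subdivision k ^^ n) (equator k c) = equator k ((singular_subdivision k ^^ n) c)"
  by (simp add: equator_def singular_subdivision_power_diff iterated_singular_subdivision_cmul
      iterated_singular_subdivision_chain_map [OF assms])

text \<open>Up to sign, the product on the \<open>Suc k\<close>-cell is the coboundary of a cochain
  \<open>a\<close>, so it can be evaluated on the equator. There the two antipodal halves contribute
  twice an integer minus the value on the \<open>k\<close>-cell, which is odd by induction.\<close>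

lemma odd_jump_prod_hemisphere:
  assumes s: "\<And>i x. i < n \<Longrightarrow> x \<in> cross_sphere n \<Longrightarrow> s i (neg_fun x) = 1 - s i x"
    and "k \<le> n"
  shows "odd (cochain_eval (\<lambda>f. jump_prod s k (vertices f)) ((singular_subdivision k ^^ N) (hemisphere k)))"
  using \<open>k \<le> n\<close>
proof (induction k)
  case 0
  have "(singular_subdivision 0 ^^ N) (hemisphere 0) = hemisphere 0"
    by (induction N)
      (simp_all add: singular_subdivision_zero [OF singular_chain_hemisphere [OF order_refl]] del: hemisphere.simps)
  then show ?case
    by (simp add: jump_prod_def)
next
  case (Suc k)
  define c where "c = (singular_subdivision k ^^ N) (hemisphere k)"
  define c' where "c' = (singular_subdivision (Suc k) ^^ N) (hemisphere (Suc k))"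
  define W where "W k f = jump_prod s k (vertices f)" for k and f :: "(nat \<Rightarrow> real) \<Rightarrow> nat \<Rightarrow> real"
  define a where "a f = W k f * s k (vertices f k)" for f
  have c: "singular_chain k (cross_top n) c"
    unfolding c_def using Suc.prems
    by (intro singular_chain_iterated_subdivision singular_chain_hemisphere) auto
  \<comment> \<open>Subdivision commutes with the boundary and with the antipodal map.\<close>
  have bc': "chain_boundary (Suc k) c' = equator k c"
    unfolding c_def c'_def
    using iterated_singular_subdivision_boundary [OF singular_chain_hemisphere [OF Suc.prems]]
    by (simp add: chain_boundary_hemisphere
        iterated_singular_subdivision_equator [OF singular_chain_hemisphere [OF order_refl]] del: hemisphere.simps)
  have "(\<Sum>j\<le>Suc k. (-1) ^ j * a (singular_face (Suc k) j f)) = (-1) ^ k * W (Suc k) f" for f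
  proof -
    have "a (singular_face (Suc k) j f)
        = jump_prod s k (omit j (vertices f)) * s k (omit j (vertices f) k)" if "j \<le> Suc k" for j
      unfolding a_def W_def
      using that by (simp add: vertices_singular_face cong: jump_prod_cong)
    then have "(\<Sum>j\<le>Suc k. (-1) ^ j * a (singular_face (Suc k) j f))
        = (\<Sum>j\<le>Suc k. (-1) ^ j * (jump_prod s k (omit j (vertices f)) * s k (omit j (vertices f) k)))"
      by (intro sum.cong) auto
    also have "\<dots> = (-1) ^ k * W (Suc k) f"
      unfolding W_def by (rule jump_prod_coboundary)
    finally show ?thesis .
  qed
  \<comment> \<open>The summand \<open>0 * 0\<close> only gives the cochain the shape of
    \<open>cochain_eval_linear\<close>.\<close>
  then have "cochain_eval a (chain_boundary (Suc k) c') = cochain_eval (\<lambda>f. (-1) ^ k * W (Suc k) f + 0 * 0) c'"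
    by (simp add: cochain_eval_boundary)
  then have eq: "cochain_eval a (equator k c) = (-1) ^ k * cochain_eval (W (Suc k)) c'"
    unfolding bc' using cochain_eval_linear [where b = 0 and \<psi> = "\<lambda>_. 0"] by simp
  have "cochain_eval a (chain_map k neg_fun c) = cochain_eval (\<lambda>f. (-1) ^ k * W k f + - ((-1) ^ k) * a f) c"
    unfolding cochain_eval_chain_map
  proof (rule cochain_eval_eq)
    fix f assume "f \<in> Poly_Mapping.keys c"
    then have "f ` standard_simplex k \<subseteq> cross_sphere n"
      using c unfolding singular_chain_def singular_simplex_subtopology by blast
    then have v: "vertices f i \<in> cross_sphere n" if "i \<le> k" for i
      using that by (simp add: image_subset_iff)
    \<comment> \<open>Replacing \<open>s i\<close> by \<open>1 - s i\<close> negates each of the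
      \<open>k\<close> differences.\<close>
    have "W k (simplex_map k neg_fun f) = (\<Prod>i<k. (-1) * (s i (vertices f (Suc i)) - s i (vertices f i)))"
      unfolding W_def jump_prod_def using Suc.prems
      by (intro prod.cong) (auto simp: vertices_simplex_map s v)
    also have "\<dots> = (-1) ^ k * W k f"
      by (simp only: W_def jump_prod_def prod.distrib prod_constant card_lessThan)
    finally show "(a \<circ> simplex_map k neg_fun) f = (-1) ^ k * W k f + - ((-1) ^ k) * a f"
      using Suc.prems by (simp add: a_def vertices_simplex_map s v algebra_simps)
  qed
  then have "cochain_eval a (equator k c) = 2 * cochain_eval a c - cochain_eval (W k) c"
    unfolding cochain_eval_linear
    by (cases "even k") (simp_all add: equator_def cochain_eval_diff cochain_eval_add)
  then have "odd (cochain_eval a (equator k c))"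
    using Suc by (simp add: W_def [abs_def] c_def)
  then show ?case
    unfolding eq by (simp add: W_def [abs_def] c'_def)
qed

section \<open>The Borsuk-Ulam theorem by fine subdivision\<close>

theorem Borsuk_Ulam_cross_sphere:
  assumes cont: "\<And>i. i < n \<Longrightarrow> continuous_on (cross_sphere n) (g i)"
    and odd: "\<And>i x. i < n \<Longrightarrow> x \<in> cross_sphere n \<Longrightarrow> g i (\<lambda>j. - x j) = - (g i x :: real)"
  obtains x where "x \<in> cross_sphere n" "\<And>i. i < n \<Longrightarrow> g i x = 0"
proof (rule ccontr)
  assume neg: "\<not> thesis"
  note common_zero = that
  have nz: "\<exists>i<n. g i x \<noteq> 0" if "x \<in> cross_sphere n" for x
  proof (rule ccontr)
    assume "\<not> (\<exists>i<n. g i x \<noteq> 0)"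
    then have "g i x = 0" if "i < n" for i
      using that by simp
    then show False
      using neg common_zero [OF \<open>x \<in> cross_sphere n\<close>] by simp
  qed
  \<comment> \<open>The sign of the first nonzero coordinate breaks ties at the zeros of
    \<open>g i\<close>, so that \<open>s i\<close> flips at every antipodal pair. No continuity of
    \<open>s i\<close> is required.\<close>
  define pos :: "(nat \<Rightarrow> real) \<Rightarrow> bool" where "pos x \<longleftrightarrow> x (LEAST i. x i \<noteq> 0) > 0" for x
  define s :: "nat \<Rightarrow> (nat \<Rightarrow> real) \<Rightarrow> int"
    where "s i x = of_bool (g i x > 0 \<or> g i x = 0 \<and> pos x)" for i x
  have "s i (neg_fun x) = 1 - s i x" if "i < n" "x \<in> cross_sphere n" for i x
  proof -
    have "\<exists>j. x j \<noteq> 0"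
      using that by (auto simp: cross_sphere_def) (metis abs_zero sum.neutral zero_neq_one)
    then have "x (LEAST j. x j \<noteq> 0) \<noteq> 0"
      by (rule LeastI_ex)
    then have "pos (neg_fun x) \<longleftrightarrow> \<not> pos x"
      by (auto simp: pos_def neg_fun_def)
    then show ?thesis
      using odd [OF that] by (auto simp: s_def neg_fun_def)
  qed
  then have odd_eval: "odd (cochain_eval (\<lambda>f. jump_prod s n (vertices f))
      ((singular_subdivision n ^^ N) (hemisphere n)))" for N
    by (rule odd_jump_prod_hemisphere) auto
  \<comment> \<open>The cover separates the two signs, so \<open>s i\<close> is constant on a
    simplex inside a member belonging to \<open>g i\<close>; then factor \<open>i\<close> of the
    product is zero.\<close>
  define \<C> where "\<C> = (\<Union>i<n. {{x \<in> cross_sphere n. g i x > 0}, {x \<in> cross_sphere n. g i x < 0}})"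
  have "openin (cross_top n) U" if U: "U \<in> \<C>" for U
  proof -
    obtain i where i: "i < n" and
      V: "U = {x \<in> cross_sphere n. g i x \<in> {0<..}} \<or> U = {x \<in> cross_sphere n. g i x \<in> {..<0}}"
      using U by (auto simp: \<C>_def)
    have "continuous_map (cross_top n) euclideanreal (g i)"
      using cont [OF i] by (simp add: euclidean_product_topology)
    then have "openin (cross_top n) {x \<in> topspace (cross_top n). g i x \<in> V}" if "open V" for V
      by (rule openin_continuous_map_preimage) (use that in simp)
    then have *: "openin (cross_top n) {x \<in> cross_sphere n. g i x \<in> V}" if "open V" for V
      using that by (simp only: topspace_subtopology topspace_product_topology PiE_UNIV_domain
          topspace_euclidean Int_UNIV_left UNIV_I Pi_UNIV simp_thms)
    show ?thesis
      using V *[OF open_greaterThan, of 0] *[OF open_lessThan, of 0] by (elim disjE) (simp_all only:)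
  qed
  moreover have "topspace (cross_top n) \<subseteq> \<Union>\<C>"
  proof
    fix x assume "x \<in> topspace (cross_top n)"
    then have x: "x \<in> cross_sphere n"
      by simp
    then obtain i where i: "i < n" "g i x > 0 \<or> g i x < 0"
      using nz [OF x] neq_iff by blast
    then have "x \<in> {x \<in> cross_sphere n. g i x > 0} \<union> {x \<in> cross_sphere n. g i x < 0}"
      using x by simp
    then show "x \<in> \<Union>\<C>"
      unfolding \<C>_def using i(1) by blast
  qed
  ultimately have "\<exists>N. \<forall>f\<in>Poly_Mapping.keys ((singular_subdivision n ^^ N) (hemisphere n)).
      \<exists>V\<in>\<C>. f \<in> standard_simplex n \<rightarrow> V"
  proof (rule sufficient_iterated_singular_subdivision_exists [OF _ _ singular_chain_hemisphere [OF order_refl]])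
    fix N
    assume "\<And>m f. N \<le> m \<Longrightarrow> f \<in> Poly_Mapping.keys ((singular_subdivision n ^^ m) (hemisphere n))
      \<Longrightarrow> \<exists>V\<in>\<C>. f \<in> standard_simplex n \<rightarrow> V"
    from this [OF order_refl] show ?thesis
      by (intro exI [of _ N] ballI)
  qed
  then obtain N where N: "\<forall>f\<in>Poly_Mapping.keys ((singular_subdivision n ^^ N) (hemisphere n)).
      \<exists>V\<in>\<C>. f \<in> standard_simplex n \<rightarrow> V" ..
  have "jump_prod s n (vertices f) = 0"
    if f: "f \<in> Poly_Mapping.keys ((singular_subdivision n ^^ N) (hemisphere n))" for f
  proof -
    obtain V where "V \<in> \<C>" and fV: "f \<in> standard_simplex n \<rightarrow> V"
      using bspec [OF N f] ..
    then obtain i where i: "i < n"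
      and V: "V \<in> {{x \<in> cross_sphere n. g i x > 0}, {x \<in> cross_sphere n. g i x < 0}}"
      unfolding \<C>_def by blast
    have "(\<forall>x\<in>standard_simplex n. g i (f x) > 0) \<or> (\<forall>x\<in>standard_simplex n. g i (f x) < 0)"
      using fV V by (auto simp: Pi_iff)
    moreover have "unit_at i \<in> standard_simplex n" "unit_at (Suc i) \<in> standard_simplex n"
      using i by simp_all
    ultimately have "0 < g i (vertices f i) \<and> 0 < g i (vertices f (Suc i)) \<or>
        g i (vertices f i) < 0 \<and> g i (vertices f (Suc i)) < 0"
      by blast
    then have "s i (vertices f (Suc i)) = s i (vertices f i)"
      by (auto simp: s_def)
    then show ?thesis
      using i by (auto simp: jump_prod_def)
  qed
  then have "cochain_eval (\<lambda>f. jump_prod s n (vertices f)) ((singular_subdivision n ^^ N) (hemisphere n)) = 0"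
    by (rule cochain_eval_eq_0)
  then show False
    using odd_eval [of N] by simp
qed

subsection \<open>Non-intersecting families\<close>

lemma geometric_realization_points:
  assumes "finite A" "K \<subseteq> Pow A"
  shows "topspace (geometric_realization K)
    = {x. (\<forall>v. 0 \<le> x v) \<and> {v. x v \<noteq> 0} \<in> K \<and> (\<Sum>v\<in>A. x v) = 1}"
proof -
  have "(\<Sum>v\<in>{v. x v \<noteq> 0}. x v) = (\<Sum>v\<in>A. x v)" if "{v. x v \<noteq> 0} \<in> K" for x :: "'a \<Rightarrow> real"
    using that assms by (intro sum.mono_neutral_left) auto
  then show ?thesis
    by (auto simp: geometric_realization_def)
qed

lemma continuous_map_geometric_realization_coordinate:
  "continuous_map (geometric_realization K) euclideanreal (\<lambda>x. x v)"
  unfolding geometric_realization_def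
  by (intro continuous_map_from_subtopology continuous_map_product_projection) auto

text \<open>A point of the boundary of a simplex is recovered from its differences with one fixed
  coordinate, because its smallest coordinate is zero.\<close>

lemma eq_of_differences_eq:
  fixes x y :: "'a \<Rightarrow> real"
  assumes "\<And>i. i \<in> S \<Longrightarrow> 0 \<le> x i" "\<And>i. i \<in> S \<Longrightarrow> 0 \<le> y i"
    and "p \<in> S" "x p = 0" "q \<in> S" "y q = 0"
    and "\<And>i. i \<in> S \<Longrightarrow> x i - x a = y i - y a"
    and "i \<in> S"
  shows "x i = y i"
proof -
  have "x p - x a = y p - y a" "x q - x a = y q - y a"
    using assms by blast+
  then have "x a = y a"
    using assms by (smt (verit, best))
  then show ?thesis
    using assms by auto
qed

text \<open>Dropping one reference vertex from each of \<open>A\<close> and \<open>B\<close> leaves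
  \<open>d + 1\<close> differences, the number of coordinates of the ambient space of the sphere.
  Their direction determines the point, because the coordinate sum fixes the scale.\<close>

lemma embeds_into_nsphere_if_two_missing:
  fixes A B :: "'v set"
  assumes disj: "A \<inter> B = {}" and fin: "finite A" "finite B" and ne: "A \<noteq> {}" "B \<noteq> {}"
    and card: "card (A \<union> B) = d + 3"
    and K: "K \<subseteq> Pow (A \<union> B)" "\<And>\<sigma>. \<sigma> \<in> K \<Longrightarrow> \<not> A \<subseteq> \<sigma> \<and> \<not> B \<subseteq> \<sigma>"
  shows "embeds_into K (nsphere d)"
proof -
  obtain a b where a: "a \<in> A" and b: "b \<in> B"
    using ne by blast
  have "card (A \<union> B - {a, b}) = d + 1"
  proof -
    have "a \<noteq> b"
      using a b disj by blast
    then show ?thesis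
      using a b fin card by (subst card_Diff_subset) auto
  qed
  then obtain h where h: "bij_betw h {..d} (A \<union> B - {a, b})"
    using finite_same_card_bij [of "{..d}" "A \<union> B - {a, b}"] fin by auto
  define base where "base v = (if v \<in> A then a else b)" for v
  define D where "D x j = x (h j) - x (base (h j))" for x :: "'v \<Rightarrow> real" and j
  define N where "N x = sqrt (\<Sum>j\<le>d. (D x j)\<^sup>2)" for x
  define f where "f x j = (if j \<le> d then D x j / N x else 0)" for x j
  let ?X = "geometric_realization K"
  have X: "topspace ?X = {x. (\<forall>v. 0 \<le> x v) \<and> {v. x v \<noteq> 0} \<in> K \<and> (\<Sum>v\<in>A \<union> B. x v) = 1}"
    using geometric_realization_points [OF _ K(1)] fin by auto
  \<comment> \<open>Proportional differences suffice: \<open>c = 0\<close> shows that the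
    differences do not all vanish, and \<open>c = N x / N y\<close> yields injectivity.\<close>
  have eqI: "x v = c * y v"
    if x: "x \<in> topspace ?X" and y: "y \<in> topspace ?X" and "c \<ge> 0"
      and D: "\<And>j. j \<le> d \<Longrightarrow> D x j = c * D y j" and v: "v \<in> A \<union> B" for x y c v
  proof -
    have diff: "x v - x (base v) = c * y v - c * y (base v)" if v: "v \<in> A \<union> B" for v
    proof (cases "v \<in> {a, b}")
      case True
      then show ?thesis using a b disj by (auto simp: base_def)
    next
      case False
      then obtain j where "j \<le> d" "v = h j"
        using h v unfolding bij_betw_def by blast
      then show ?thesis
        using D [of j] by (simp add: D_def algebra_simps)
    qed
    \<comment> \<open>No face contains \<open>A\<close> or \<open>B\<close>, so each point has a
      zero coordinate in both sets.\<close>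
    obtain p q p' q' where "p \<in> A" "x p = 0" "q \<in> A" "y q = 0" "p' \<in> B" "x p' = 0" "q' \<in> B" "y q' = 0"
      using x y K(2) [of "{v. x v \<noteq> 0}"] K(2) [of "{v. y v \<noteq> 0}"] by (auto simp: X)
    have "base v = a" if "v \<in> A" for v
      using that by (simp add: base_def)
    moreover have "base v = b" if "v \<in> B" for v
      using that disj by (auto simp: base_def)
    ultimately have "x i - x a = c * y i - c * y a" if "i \<in> A" for i
      using diff [of i] that by simp
    moreover have "x i - x b = c * y i - c * y b" if "i \<in> B" for i
      using diff [of i] that \<open>\<And>v. v \<in> B \<Longrightarrow> base v = b\<close> by simp
    ultimately show ?thesis
      using v eq_of_differences_eq [of A x "\<lambda>i. c * y i" p q a v] eq_of_differences_eq [of B x "\<lambda>i. c * y i" p' q' b v]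
        \<open>p \<in> A\<close> \<open>x p = 0\<close> \<open>q \<in> A\<close> \<open>y q = 0\<close> \<open>p' \<in> B\<close> \<open>x p' = 0\<close> \<open>q' \<in> B\<close> \<open>y q' = 0\<close> x y \<open>c \<ge> 0\<close>
      by (auto simp: X)
  qed
  have Npos: "N x > 0" if x: "x \<in> topspace ?X" for x
  proof (rule ccontr)
    assume "\<not> N x > 0"
    then have "(\<Sum>j\<le>d. (D x j)\<^sup>2) = 0"
      using sum_nonneg [of "{..d}" "\<lambda>j. (D x j)\<^sup>2"] by (simp add: N_def)
    then have "D x j = 0 * D x j" if "j \<le> d" for j
      using that by (simp add: sum_nonneg_eq_0_iff)
    then have "x v = 0" if "v \<in> A \<union> B" for v
      using eqI [OF x x, of 0] that by simp
    then show False
      using x by (simp add: X)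
  qed
  have contD: "continuous_map ?X euclideanreal (\<lambda>x. D x j)" for j
    unfolding D_def by (intro continuous_map_diff continuous_map_geometric_realization_coordinate)
  have "continuous_map ?X euclideanreal N"
    unfolding N_def by (intro continuous_map_sqrt continuous_map_sum continuous_map_real_pow contD) auto
  then have "continuous_map ?X euclideanreal (\<lambda>x. f x j)" for j
    using Npos by (cases "j \<le> d") (auto simp: f_def less_le intro!: continuous_map_real_divide contD)
  moreover have "(\<Sum>j\<le>d. (f x j)\<^sup>2) = 1" if "x \<in> topspace ?X" for x
  proof -
    have "(\<Sum>j\<le>d. (f x j)\<^sup>2) = (\<Sum>j\<le>d. (D x j)\<^sup>2) / (N x)\<^sup>2"
      by (simp add: f_def power_divide sum_divide_distrib)
    also have "\<dots> = 1"
      using Npos [OF that] by (simp add: N_def sum_nonneg)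
    finally show ?thesis .
  qed
  ultimately have "continuous_map ?X (nsphere d) f"
    by (auto simp: nsphere continuous_map_in_subtopology continuous_map_componentwise_UNIV f_def)
  moreover have "inj_on f (topspace ?X)"
  proof (rule inj_onI)
    fix x y assume x: "x \<in> topspace ?X" and y: "y \<in> topspace ?X" and "f x = f y"
    define c where "c = N x / N y"
    have Dxy: "D x j = c * D y j" if "j \<le> d" for j
      using fun_cong [OF \<open>f x = f y\<close>, of j] that Npos [OF x] Npos [OF y] by (simp add: f_def c_def field_simps)
    have "0 \<le> c"
      using Npos [OF x] Npos [OF y] by (simp add: c_def)
    then have xy: "x v = c * y v" if "v \<in> A \<union> B" for v
      using eqI [OF x y _ Dxy that] by simp
    then have "(\<Sum>v\<in>A \<union> B. x v) = c * (\<Sum>v\<in>A \<union> B. y v)"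
      by (simp add: sum_distrib_left)
    then have "c = 1"
      using x y by (simp add: X)
    have "x v = 0" "y v = 0" if "v \<notin> A \<union> B" for v
      using x y K(1) that unfolding X by blast+
    then have "x v = y v" for v
      using xy [of v] \<open>c = 1\<close> by (cases "v \<in> A \<union> B") simp_all
    then show "x = y"
      by (rule ext)
  qed
  ultimately show ?thesis
    unfolding embeds_into_def by blast
qed

lemma embeds_into_if_not_intersecting:
  assumes "\<F> \<subseteq> Pow {1..d + 3}" "\<not> intersecting_family \<F>"
  shows "embeds_into (missing_face_complex (d + 3) \<F>) (nsphere d)"
proof -
  let ?K = "missing_face_complex (d + 3) \<F>"
  obtain A B where AB: "A \<in> \<F>" "B \<in> \<F>" "A \<inter> B = {}"
    using assms(2) by (auto simp: intersecting_family_def)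
  show ?thesis
  proof (cases "A = {} \<or> B = {}")
    case True
    \<comment> \<open>The empty set is a missing face, so the realization is empty and any map
      embeds it.\<close>
    then have "?K = {}"
      using AB by (auto simp: missing_face_complex_def)
    then show ?thesis
      unfolding embeds_into_def geometric_realization_def
      by (auto simp: continuous_map_def)
  next
    case False
    \<comment> \<open>The complement of \<open>A\<close> contains \<open>B\<close>, so no face
      contains it either, and together with \<open>A\<close> it fills the vertex set.\<close>
    have "A \<subseteq> {1..d + 3}" "B \<subseteq> {1..d + 3} - A"
      using AB assms(1) by auto
    then have eq: "A \<union> ({1..d + 3} - A) = {1..d + 3}"
      by blast
    show ?thesis
    proof (rule embeds_into_nsphere_if_two_missing)
      show "finite A" "{1..d + 3} - A \<noteq> {}"
        using \<open>A \<subseteq> {1..d + 3}\<close> \<open>B \<subseteq> {1..d + 3} - A\<close> False by (auto intro: finite_subset)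
      show "\<not> A \<subseteq> \<sigma> \<and> \<not> {1..d + 3} - A \<subseteq> \<sigma>" if "\<sigma> \<in> ?K" for \<sigma>
        using that AB \<open>B \<subseteq> {1..d + 3} - A\<close> by (auto simp: missing_face_complex_def)
      show "card (A \<union> ({1..d + 3} - A)) = d + 3" "?K \<subseteq> Pow (A \<union> ({1..d + 3} - A))"
        unfolding eq by (auto simp: missing_face_complex_def)
    qed (use False in auto)
  qed
qed

subsection \<open>Intersecting families\<close>

text \<open>Where \<open>T\<close> vanishes the quotient may behave badly, but \<open>F\<close> is
  bounded and the factor \<open>T y\<close> forces the product to 0.\<close>

lemma continuous_on_radial_rescale:
  fixes F :: "('v :: countable \<Rightarrow> real) \<Rightarrow> real" and T :: "('v \<Rightarrow> real) \<Rightarrow> real"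
  assumes F: "continuous_on UNIV F" "\<And>x. \<bar>F x\<bar> \<le> B" and T: "continuous_on UNIV T"
  shows "continuous_on UNIV (\<lambda>y. T y * F (\<lambda>v. y v / T y))"
proof -
  let ?U = "{y. T y \<noteq> 0}"
  have U: "open ?U"
    by (rule open_Collect_neq [OF T continuous_on_const])
  have TU: "continuous_on ?U T"
    by (rule continuous_on_subset [OF T subset_UNIV])
  have "continuous_on ?U (\<lambda>y v. y v / T y)"
  proof (rule continuous_on_coordinatewise_then_product)
    show "continuous_on ?U (\<lambda>y. y v / T y)" for v
      by (rule continuous_on_divide [OF continuous_on_subset [OF continuous_on_product_coordinates subset_UNIV] TU])
        simp
  qed
  then have "continuous_on ?U (\<lambda>y. F (\<lambda>v. y v / T y))"
    by (rule continuous_on_compose2 [OF F(1) _ subset_UNIV])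
  then have "continuous_on ?U (\<lambda>y. T y * F (\<lambda>v. y v / T y))"
    by (rule continuous_on_mult [OF TU])
  then have "isCont (\<lambda>y. T y * F (\<lambda>v. y v / T y)) x" if "T x \<noteq> 0" for x
    unfolding continuous_on_eq_continuous_at [OF U] using that by blast
  moreover have "isCont (\<lambda>y. T y * F (\<lambda>v. y v / T y)) x" if "T x = 0" for x
  proof -
    have "(T \<longlongrightarrow> T x) (at x)"
      using T unfolding continuous_on_def by simp
    then have "((\<lambda>y. B * \<bar>T y\<bar>) \<longlongrightarrow> 0) (at x)"
      unfolding that by (intro tendsto_mult_right_zero tendsto_rabs_zero)
    then have "((\<lambda>y. T y * F (\<lambda>v. y v / T y)) \<longlongrightarrow> 0) (at x)"
    proof (rule Lim_null_comparison [rotated])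
      have "norm (T y * F (\<lambda>v. y v / T y)) \<le> B * \<bar>T y\<bar>" for y
        unfolding real_norm_def abs_mult mult.commute [of "\<bar>T y\<bar>"]
        by (rule mult_right_mono [OF F(2) abs_ge_zero])
      then show "\<forall>\<^sub>F y in at x. norm (T y * F (\<lambda>v. y v / T y)) \<le> B * \<bar>T y\<bar>"
        by (rule always_eventually [OF allI])
    qed
    then show ?thesis
      unfolding isCont_def that by simp
  qed
  ultimately have "isCont (\<lambda>y. T y * F (\<lambda>v. y v / T y)) x" for x
    by (cases "T x = 0")
  then show ?thesis
    by (intro continuous_at_imp_continuous_on ballI)
qed

text \<open>This is the polynomial \<open>q\<close> of the overview. An empty missing face
  contributes the empty product 1, so at nonnegative points it then has no zeros, matching a complex
  without faces.\<close>

definition missing_mass :: "'v set set \<Rightarrow> ('v \<Rightarrow> real) \<Rightarrow> real" where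
  "missing_mass \<F> y = (\<Sum>\<tau>\<in>\<F>. \<Prod>v\<in>\<tau>. y v)"

lemma continuous_on_missing_mass: "continuous_on S (missing_mass \<F>)"
  unfolding missing_mass_def [abs_def]
  by (intro continuous_on_sum continuous_on_prod continuous_on_subset [OF continuous_on_product_coordinates]) auto

lemma missing_mass_eq_0_iff:
  assumes "\<F> \<subseteq> Pow {1..n}" "\<And>v. 0 \<le> y v" "{v. y v \<noteq> 0} \<subseteq> {1..n}"
  shows "missing_mass \<F> y = 0 \<longleftrightarrow> {v. y v \<noteq> 0} \<in> missing_face_complex n \<F>"
proof -
  have fin: "finite \<F>"
    by (rule finite_subset [OF assms(1)]) simp
  have fin_mem: "finite \<tau>" if "\<tau> \<in> \<F>" for \<tau>
    by (rule finite_subset [OF _ finite_atLeastAtMost]) (use assms(1) that in blast)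
  have "missing_mass \<F> y = 0 \<longleftrightarrow> (\<forall>\<tau>\<in>\<F>. (\<Prod>v\<in>\<tau>. y v) = 0)"
    unfolding missing_mass_def by (intro sum_nonneg_eq_0_iff prod_nonneg fin ballI assms(2))
  also have "\<dots> \<longleftrightarrow> (\<forall>\<tau>\<in>\<F>. \<exists>v\<in>\<tau>. y v = 0)"
    by (intro ball_cong refl prod_zero_iff fin_mem)
  also have "\<dots> \<longleftrightarrow> {v. y v \<noteq> 0} \<in> missing_face_complex n \<F>"
    using assms(3) unfolding missing_face_complex_def by blast
  finally show ?thesis .
qed

text \<open>Tietze's theorem needs a closed domain. The support condition is turned into vanishing
  of continuous functions, which is possible for nonnegative coordinates.\<close>

lemma closed_realization:
  assumes "\<F> \<subseteq> Pow {1..n}"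
  shows "closed (topspace (geometric_realization (missing_face_complex n \<F>)))"
proof -
  let ?K = "missing_face_complex n \<F>"
  have K: "?K \<subseteq> Pow {1..n}"
    by (auto simp: missing_face_complex_def)
  have "{v. x v \<noteq> 0} \<in> ?K \<longleftrightarrow> (\<forall>v. v \<notin> {1..n} \<longrightarrow> x v = 0) \<and> missing_mass \<F> x = 0"
    if x: "\<And>v. 0 \<le> x v" for x
  proof (cases "{v. x v \<noteq> 0} \<subseteq> {1..n}")
    case True
    then have "\<forall>v. v \<notin> {1..n} \<longrightarrow> x v = 0"
      by blast
    then show ?thesis
      using missing_mass_eq_0_iff [OF assms x True] by simp
  next
    case False
    then show ?thesis
      unfolding missing_face_complex_def by blast
  qed
  then have eq: "topspace (geometric_realization ?K) = {x. (\<forall>v. 0 \<le> x v) \<and>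
      ((\<forall>v. v \<notin> {1..n} \<longrightarrow> x v = 0) \<and> missing_mass \<F> x = 0) \<and> (\<Sum>v\<in>{1..n}. x v) = 1}"
    unfolding geometric_realization_points [OF finite_atLeastAtMost K]
    by (intro Collect_cong) (rule conj_cong [OF refl], simp)
  have "closed {x::nat \<Rightarrow> real. v \<notin> {1..n} \<longrightarrow> x v = 0}" for v
    by (cases "v \<in> {1..n}")
      (simp_all only: simp_thms not_True_eq_False not_False_eq_True Collect_const if_True closed_UNIV
        closed_Collect_eq [OF continuous_on_product_coordinates continuous_on_const])
  then show ?thesis
    unfolding eq
    by (intro closed_Collect_conj closed_Collect_all closed_Collect_le closed_Collect_eq
        continuous_on_missing_mass continuous_on_const continuous_on_product_coordinates continuous_on_sum)
qed

section \<open>Reduction to the Borsuk-Ulam theorem\<close>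

lemma not_embeds_into_if_intersecting:
  assumes \<F>: "\<F> \<subseteq> Pow {1..d + 3}" and "intersecting_family \<F>"
  shows "\<not> embeds_into (missing_face_complex (d + 3) \<F>) (nsphere d)"
proof
  let ?V = "{1..d + 3}"
  let ?K = "missing_face_complex (d + 3) \<F>"
  define R where "R = topspace (geometric_realization ?K)"
  assume "embeds_into ?K (nsphere d)"
  then obtain f where f: "continuous_map (geometric_realization ?K) (nsphere d) f" and inj: "inj_on f R"
    unfolding embeds_into_def R_def by blast
  have K: "?K \<subseteq> Pow ?V"
    by (auto simp: missing_face_complex_def)
  have R: "R = {x. (\<forall>v. 0 \<le> x v) \<and> {v. x v \<noteq> 0} \<in> ?K \<and> (\<Sum>v\<in>?V. x v) = 1}"
    unfolding R_def by (rule geometric_realization_points [OF finite_atLeastAtMost K])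
  have f_sphere: "(\<Sum>j\<le>d. (f x j)\<^sup>2) = 1" "\<And>j. j > d \<Longrightarrow> f x j = 0" if "x \<in> R" for x
  proof -
    have "f x \<in> topspace (nsphere d)"
      using continuous_map_image_subset_topspace [OF f] that by (auto simp: R_def)
    then show "(\<Sum>j\<le>d. (f x j)\<^sup>2) = 1" "\<And>j. j > d \<Longrightarrow> f x j = 0"
      by (simp_all add: nsphere)
  qed
  have "\<forall>j\<in>{..d}. \<exists>F. continuous_on UNIV F \<and> (\<forall>x\<in>R. F x = f x j) \<and> (\<forall>x. \<bar>F x\<bar> \<le> 1)"
  proof
    fix j assume "j \<in> {..d}"
    then have "j \<le> d"
      by simp
    have "continuous_map (geometric_realization ?K) euclideanreal (\<lambda>x. f x j)"
      using continuous_map_compose [OF f continuous_map_nsphere_projection] by (simp add: o_def)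
    moreover have "geometric_realization ?K = top_of_set R"
      unfolding R_def geometric_realization_def by (simp add: euclidean_product_topology)
    ultimately have cont: "continuous_on R (\<lambda>x. f x j)"
      by simp
    have bound: "norm (f x j) \<le> 1" if "x \<in> R" for x
    proof -
      have "(f x j)\<^sup>2 \<le> (\<Sum>j\<le>d. (f x j)\<^sup>2)"
        using \<open>j \<le> d\<close> by (intro member_le_sum) auto
      then show ?thesis
        using f_sphere(1) [OF that] by (simp add: abs_square_le_1)
    qed
    have clo: "closedin (top_of_set UNIV) R"
      using closed_realization [OF \<F>] by (simp add: R_def)
    show "\<exists>F. continuous_on UNIV F \<and> (\<forall>x\<in>R. F x = f x j) \<and> (\<forall>x. \<bar>F x\<bar> \<le> 1)"
    proof (rule Tietze [OF cont clo zero_le_one bound])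
      fix F :: "(nat \<Rightarrow> real) \<Rightarrow> real"
      assume "continuous_on UNIV F" "\<And>x. x \<in> R \<Longrightarrow> F x = f x j" "\<And>x. x \<in> UNIV \<Longrightarrow> norm (F x) \<le> 1"
      then show ?thesis
        by (intro exI [of _ F]) simp
    qed
  qed
  from bchoice [OF this] obtain F where F0:
    "\<forall>j\<in>{..d}. continuous_on UNIV (F j) \<and> (\<forall>x\<in>R. F j x = f x j) \<and> (\<forall>x. \<bar>F j x\<bar> \<le> 1)" ..
  have F: "continuous_on UNIV (F j)" "\<And>x. x \<in> R \<Longrightarrow> F j x = f x j" "\<And>x. \<bar>F j x\<bar> \<le> 1" if "j \<le> d" for j
    using bspec [OF F0, of j] that by auto
  define T where "T y = (\<Sum>v\<in>?V. y v)" for y :: "nat \<Rightarrow> real"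
  define P where "P j y = T y * F j (\<lambda>v. y v / T y)" for j y
  \<comment> \<open>The shift matches the vertices 1 to \<open>d + 3\<close> with the sphere
    coordinates 0 to \<open>d + 2\<close>.\<close>
  define pp where "pp x v = (if v \<in> ?V then max (x (v - 1)) 0 else 0)" for x :: "nat \<Rightarrow> real" and v
  \<comment> \<open>Indices up to \<open>d\<close> carry the rescaled coordinates of the embedding
    and index \<open>d + 1\<close> the missing mass, which makes \<open>d + 2\<close>
    functions.\<close>
  define G where "G j y = (if j \<le> d then P j y else missing_mass \<F> y)" for j y
  define g where "g j x = G j (pp x) - G j (pp (\<lambda>i. - x i))" for j x
  have contT: "continuous_on UNIV T"
    unfolding T_def by (intro continuous_on_sum continuous_on_product_coordinates)
  have contG: "continuous_on UNIV (G j)" for j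
    using continuous_on_radial_rescale [OF F(1) F(3) contT]
    by (cases "j \<le> d") (auto simp: G_def [abs_def] P_def [abs_def] continuous_on_missing_mass)
  have contpp: "continuous_on UNIV (\<lambda>x. pp (\<lambda>i. c * x i))" for c
  proof (rule continuous_on_coordinatewise_then_product)
    show "continuous_on UNIV (\<lambda>x. pp (\<lambda>i. c * x i) v)" for v
      unfolding pp_def
      by (cases "v \<in> ?V")
        (simp_all only: if_True if_False continuous_on_const, intro continuous_on_max continuous_on_mult
          continuous_on_const continuous_on_product_coordinates)
  qed
  have contg: "continuous_on UNIV (g j)" for j
    using continuous_on_compose2 [OF contG contpp [of 1]] continuous_on_compose2 [OF contG contpp [of "-1"]]
    by (auto simp: g_def [abs_def] intro!: continuous_on_diff)
  obtain x where x: "x \<in> cross_sphere (d + 2)" and gx: "\<And>j. j < d + 2 \<Longrightarrow> g j x = 0"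
  proof (rule Borsuk_Ulam_cross_sphere [of "d + 2" g])
    show "continuous_on (cross_sphere (d + 2)) (g j)" for j
      using contg continuous_on_subset by blast
  qed (auto simp: g_def)
  define y where "y = pp x"
  define z where "z = pp (\<lambda>i. - x i)"
  have nonneg: "0 \<le> y v" "0 \<le> z v" and supp: "{v. y v \<noteq> 0} \<subseteq> ?V" "{v. z v \<noteq> 0} \<subseteq> ?V"
    and disj: "y v = 0 \<or> z v = 0" for v
    by (auto simp: y_def z_def pp_def)
  have "T y + T z = (\<Sum>v\<in>Suc ` {..d + 2}. \<bar>x (v - 1)\<bar>)"
    unfolding T_def sum.distrib [symmetric] image_Suc_atMost
    by (intro sum.cong) (auto simp: y_def z_def pp_def)
  also have "\<dots> = 1"
    using x by (simp add: sum.reindex cross_sphere_def)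
  finally have Tyz: "T y + T z = 1" .
  \<comment> \<open>Two non-faces would contain members of the family that are disjoint, as the
    supports of \<open>y\<close> and \<open>z\<close> are.\<close>
  have "{v. y v \<noteq> 0} \<in> ?K \<or> {v. z v \<noteq> 0} \<in> ?K"
  proof (rule ccontr)
    assume "\<not> ?thesis"
    then obtain \<sigma> \<tau> where "\<sigma> \<in> \<F>" "\<sigma> \<subseteq> {v. y v \<noteq> 0}" "\<tau> \<in> \<F>" "\<tau> \<subseteq> {v. z v \<noteq> 0}"
      using supp unfolding missing_face_complex_def by blast
    moreover have "\<sigma> \<inter> \<tau> = {}"
      using calculation disj by blast
    ultimately show False
      using assms(2) unfolding intersecting_family_def by blast
  qed
  \<comment> \<open>One of these masses is zero, hence both are.\<close>
  moreover have "missing_mass \<F> y = missing_mass \<F> z"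
    using gx [of "d + 1"] by (simp add: g_def G_def y_def z_def)
  ultimately have yK: "{v. y v \<noteq> 0} \<in> ?K" and zK: "{v. z v \<noteq> 0} \<in> ?K"
    using missing_mass_eq_0_iff [OF \<F> nonneg(1) supp(1)] missing_mass_eq_0_iff [OF \<F> nonneg(2) supp(2)]
    by auto
  have in_R: "(\<lambda>v. w v / T w) \<in> R"
    if "\<And>v. 0 \<le> w v" "{v. w v \<noteq> 0} \<in> ?K" "T w \<noteq> 0" for w
    using that sum_nonneg [of ?V w] by (auto simp: R T_def simp flip: sum_divide_distrib)
  \<comment> \<open>Over the complex \<open>f\<close> has unit length, so the vector
    \<open>P\<close> recovers the total \<open>T w\<close>; agreement of \<open>P\<close> at
    \<open>y\<close> and \<open>z\<close> thus forces equal totals.\<close>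
  have norm: "(\<Sum>j\<le>d. (P j w)\<^sup>2) = (T w)\<^sup>2"
    if w: "\<And>v. 0 \<le> w v" "{v. w v \<noteq> 0} \<in> ?K" for w
  proof (cases "T w = 0")
    case False
    have "(\<Sum>j\<le>d. (P j w)\<^sup>2) = (\<Sum>j\<le>d. (T w)\<^sup>2 * (f (\<lambda>v. w v / T w) j)\<^sup>2)"
      using F(2) [OF _ in_R [OF w False]] by (intro sum.cong) (auto simp: P_def power_mult_distrib)
    then show ?thesis
      using f_sphere(1) [OF in_R [OF w False]] by (simp flip: sum_distrib_left)
  qed (simp add: P_def)
  have P_eq: "P j y = P j z" if "j \<le> d" for j
    using gx [of j] that by (simp add: g_def G_def y_def z_def)
  then have "(T y)\<^sup>2 = (T z)\<^sup>2"
    using norm [OF nonneg(1) yK] norm [OF nonneg(2) zK] by simp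
  moreover have "0 \<le> T y" "0 \<le> T z"
    using nonneg by (auto simp: T_def intro: sum_nonneg)
  ultimately have "T y = T z"
    by simp
  then have T: "T y = 1 / 2" "T z = 1 / 2"
    using Tyz by auto
  then have Ry: "(\<lambda>v. 2 * y v) \<in> R" and Rz: "(\<lambda>v. 2 * z v) \<in> R"
    using in_R [OF nonneg(1) yK] in_R [OF nonneg(2) zK] by (simp_all add: T mult.commute)
  have "f (\<lambda>v. 2 * y v) j = f (\<lambda>v. 2 * z v) j" for j
  proof (cases "j \<le> d")
    case True
    then have "F j (\<lambda>v. 2 * y v) = F j (\<lambda>v. 2 * z v)"
      using P_eq [OF True] by (simp add: P_def T mult.commute)
    then show ?thesis
      using F(2) [OF True Ry] F(2) [OF True Rz] by simp
  next
    case False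
    then show ?thesis
      using f_sphere(2) [OF Ry] f_sphere(2) [OF Rz] by simp
  qed
  then have "f (\<lambda>v. 2 * y v) = f (\<lambda>v. 2 * z v)"
    by (rule ext)
  then have eq: "(\<lambda>v. 2 * y v) = (\<lambda>v. 2 * z v)"
    by (rule inj_onD [OF inj _ Ry Rz])
  have "y v = 0" for v
    using fun_cong [OF eq, of v] disj [of v] by simp
  then have "T y = 0"
    by (simp add: T_def)
  then show False
    using T by simp
qed

theorem theorem1p1:
  fixes d :: nat and \<F> :: "nat set set"
  assumes "\<F> \<subseteq> Pow {1..d + 3}"
  shows "embeds_into (missing_face_complex (d + 3) \<F>) (nsphere d) \<longleftrightarrow> \<not> intersecting_family \<F>"
  using embeds_into_if_not_intersecting [OF assms] not_embeds_into_if_intersecting [OF assms] by blast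

end
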